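(* Let $C$ be a closed $C^2$ curve in the Euclidean plane with non-vanishing curvature and total curvature $2k\pi$, given by $$X:[0,2k\pi)\to\mathbb R^2,\quad X(\varphi)=p(\varphi)u(\varphi)+p'(\varphi)u'(\varphi).$$ Let $\alpha_1,\ldots,\alpha_n$ be given external angles, none of them an integer multiple of $\pi$, such that $\alpha_1+\cdots+\alpha_n=2m\pi$ for a natural number $m\ge1$. Then the curves $(C,K_1,\ldots,K_n)$ form a Poncelet clan, where the vertex curve $K_i$ is given by the parametrization $$K_i:[0,2k\pi)\to\mathbb R^2,\quad\varphi\mapsto Y_i(\varphi)=\frac{1}{\sin\alpha_i}\bigl(p(\varphi+\alpha_i)u'(\varphi)-p(\varphi)u'(\varphi+\alpha_i)\bigr).$$ The polygon $P(\varphi)$ with vertices $$Y_1(\varphi),\ Y_2(\varphi+\alpha_1),\ \ldots,\ Y_n(\varphi+\alpha_1+\cdots+\alpha_{n-1}),\ Y_1(\varphi+2\pi m),\ Y_2(\varphi+2\pi m+\alpha_1),\ \ldots,\ Y_n(\varphi+2\pi m+\alpha_1+\cdots+\alpha_{n-1}),\ Y_1(\varphi+4\pi m),\ \ldots$$ is a Poncelet polygon for each value of $\varphi$.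
   Context: Notation: $u(\varphi)=(\cos\varphi,\sin\varphi)$, $u'(\varphi)=(-\sin\varphi,\cos\varphi)$. Here $k\in\mathbb N$, $k>0$, $p$ is a $C^2$ support function (extended $2k\pi$-periodically), and $\rho(\varphi)=p(\varphi)+p''(\varphi)>0$ is the radius of curvature of $C$ at $X(\varphi)$. Poncelet clan: closed curves $(C,K_1,\ldots,K_n)$ form a Poncelet clan if they have the following closing property: if a polygon circumscribed about $C$ exists each of whose vertices belongs to one of the curves $K_1,\ldots,K_n$, then infinitely many such polygons exist which have their vertices on $K_1,\ldots,K_n$ in the same order (here: cyclically in the order $K_1,K_2,\ldots,K_n,K_1,K_2,\ldots$). Such closed polygons are called Poncelet polygons. Circumscribed about $C$ means that the line containing each side is tangent to $C$ (the contact point may lie on the prolongation of the side). The list of vertices of $P(\varphi)$ continues until the polygon closes up, i.e. until the total parameter shift $2\pi m l$ is a multiple of the period $2k\pi$. *)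

theory Defs
  imports "HOL-Analysis.Analysis"
begin

definition u :: "real \<Rightarrow> real^2" where
  "u \<phi> = vector [cos \<phi>, sin \<phi>]"

definition u' :: "real \<Rightarrow> real^2" where
  "u' \<phi> = vector [- sin \<phi>, cos \<phi>]"

definition support_curve :: "(real \<Rightarrow> real) \<Rightarrow> (real \<Rightarrow> real) \<Rightarrow> real \<Rightarrow> real^2" where
  "support_curve p p' \<phi> = p \<phi> *\<^sub>R u \<phi> + p' \<phi> *\<^sub>R u' \<phi>"

definition vertex_curve :: "(real \<Rightarrow> real) \<Rightarrow> real \<Rightarrow> real \<Rightarrow> real^2" where
  "vertex_curve p \<alpha> \<phi> =
     (1 / sin \<alpha>) *\<^sub>R (p (\<phi> + \<alpha>) *\<^sub>R u' \<phi> - p \<phi> *\<^sub>R u' (\<phi> + \<alpha>))"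

text \<open>A closed curve parametrized on the half-open interval from 0 to L is represented by
  its L-periodic extension to the real line.\<close>

definition closed_curve :: "real \<Rightarrow> (real \<Rightarrow> real^2) \<Rightarrow> bool" where
  "closed_curve L c \<longleftrightarrow> L > 0 \<and> continuous_on UNIV c \<and> (\<forall>t. c (t + L) = c t)"

definition regular_curve :: "(real \<Rightarrow> real^2) \<Rightarrow> bool" where
  "regular_curve c \<longleftrightarrow> (\<forall>t. c differentiable at t \<and> vector_derivative c (at t) \<noteq> 0)"

definition tangent_line :: "(real \<Rightarrow> real^2) \<Rightarrow> real \<Rightarrow> (real^2) set" where
  "tangent_line c t = {c t + s *\<^sub>R vector_derivative c (at t) | s. True}"

text \<open>A closed polygon is the cyclic list of its vertices. It is circumscribed if every side lies
  on a tangent line, where the contact point need not lie on the side itself. Consecutive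
  sides are carried by different tangent lines, so that each vertex is the intersection point of
  its two side lines; this excludes polygons that run back and forth on one tangent.
  Consecutive vertices are allowed to coincide: this does happen when three of the
  tangents are concurrent, and then the line carrying the degenerate side is not determined by
  the vertices. This is why the contact parameters t are quantified explicitly.\<close>

definition circumscribed :: "real \<Rightarrow> (real \<Rightarrow> real^2) \<Rightarrow> (real^2) list \<Rightarrow> bool" where
  "circumscribed L C V \<longleftrightarrow>
     (\<exists>t :: nat \<Rightarrow> real. \<forall>j < length V.
        t j \<in> {0..<L} \<and>
        closed_segment (V ! j) (V ! (Suc j mod length V)) \<subseteq> tangent_line C (t j) \<and>
        tangent_line C (t j) \<noteq> tangent_line C (t (Suc j mod length V)))"

text \<open>The curves \<open>K 0, \<dots>, K (n - 1)\<close> are visited in cyclic order; \<open>n dvd length V\<close> says that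
  this order is also respected when passing from the last vertex back to the first.\<close>

definition poncelet_polygon ::
    "real \<Rightarrow> nat \<Rightarrow> (real \<Rightarrow> real^2) \<Rightarrow> (nat \<Rightarrow> real \<Rightarrow> real^2) \<Rightarrow> (real^2) list \<Rightarrow> bool" where
  "poncelet_polygon L n C K V \<longleftrightarrow>
     V \<noteq> [] \<and> n dvd length V \<and>
     (\<forall>j < length V. V ! j \<in> K (j mod n) ` {0..<L}) \<and>
     circumscribed L C V"

text \<open>Polygons are counted by their vertex sets: running through the same polygon several times
  or from another starting vertex does not give a new polygon.\<close>

definition poncelet_clan ::
    "real \<Rightarrow> nat \<Rightarrow> (real \<Rightarrow> real^2) \<Rightarrow> (nat \<Rightarrow> real \<Rightarrow> real^2) \<Rightarrow> bool" where
  "poncelet_clan L n C K \<longleftrightarrow>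
     closed_curve L C \<and> regular_curve C \<and> (\<forall>i < n. closed_curve L (K i)) \<and>
     ((\<exists>V. poncelet_polygon L n C K V) \<longrightarrow>
        infinite (set ` {V. poncelet_polygon L n C K V}))"

text \<open>The number l of rounds after which the total parameter shift is a multiple of the
  period for the first time.\<close>

definition closing_rounds :: "nat \<Rightarrow> nat \<Rightarrow> nat" where
  "closing_rounds k m =
     (LEAST l. l > 0 \<and> (\<exists>q :: nat. 2 * pi * real m * real l = real q * (2 * real k * pi)))"

definition polygon_P ::
    "(real \<Rightarrow> real) \<Rightarrow> nat \<Rightarrow> nat \<Rightarrow> nat \<Rightarrow> (nat \<Rightarrow> real) \<Rightarrow> real \<Rightarrow> (real^2) list" where
  "polygon_P p k m n \<alpha> \<phi> =
     map (\<lambda>j. vertex_curve p (\<alpha> (j mod n))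
                (\<phi> + 2 * pi * real m * real (j div n) + (\<Sum>i < j mod n. \<alpha> i)))
       [0..<n * closing_rounds k m]"

end

theory Submission
  imports Defs
begin

text \<open>
  The tangent of \<open>C\<close> at the parameter \<open>\<phi>\<close> is the line \<open>u \<phi> \<bullet> x = p \<phi>\<close>, because
  \<open>X' = (p + p'') u'\<close>. Solving two such equations shows that \<open>Y\<^sub>i \<phi>\<close> is the
  intersection point of the tangents at \<open>\<phi>\<close> and \<open>\<phi> + \<alpha>\<^sub>i\<close>, which are not parallel since
  \<open>sin \<alpha>\<^sub>i \<noteq> 0\<close>. Hence, if the tangents at \<open>\<theta> 0, \<theta> 1, \<dots>\<close> are taken in turn, where
  \<open>\<theta> (j + 1) - \<theta> j\<close> runs cyclically through the external angles, consecutive tangents meet in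
  the vertices of \<open>P(\<phi>)\<close>. The angles add up to \<open>2 \<pi> m\<close>, so after \<open>l\<close> rounds the
  parameter has moved by \<open>2 \<pi> m l\<close>; this is a multiple of the period \<open>2 k \<pi>\<close> for a suitable
  \<open>l\<close> (for example for \<open>l = k\<close>), and the polygon closes up.

  There are infinitely many such polygons for the following reason. Every point of the curve
  \<open>K\<^sub>1\<close> is a vertex of one of them, so finitely many vertex sets would leave only finitely
  many points on \<open>K\<^sub>1\<close>. A continuous curve with finitely many points is constant, say equal
  to \<open>y\<close>. Then all tangents of \<open>C\<close> pass through \<open>y\<close>, that is \<open>p = u \<bullet> y\<close>, and
  \<open>p + p'' = 0\<close>, whereas the radius of curvature \<open>p + p''\<close> is positive.
\<close>

section \<open>The moving frame\<close>

lemma u_alt: "u \<phi> = cos \<phi> *\<^sub>R axis 1 1 + sin \<phi> *\<^sub>R axis 2 1"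
  by (simp add: u_def vec_eq_iff forall_2 axis_def)

lemma u'_alt: "u' \<phi> = (- sin \<phi>) *\<^sub>R axis 1 1 + cos \<phi> *\<^sub>R axis 2 1"
  by (simp add: u'_def vec_eq_iff forall_2 axis_def)

lemma has_vector_derivative_u: "(u has_vector_derivative u' \<phi>) (at \<phi>)"
  unfolding u_alt u'_alt by (auto intro!: derivative_eq_intros)

lemma has_vector_derivative_u': "(u' has_vector_derivative - u \<phi>) (at \<phi>)"
  unfolding u_alt u'_alt by (auto intro!: derivative_eq_intros)

lemma continuous_on_u [continuous_intros]: "continuous_on S u"
  unfolding u_alt by (intro continuous_intros)

lemma continuous_on_u' [continuous_intros]: "continuous_on S u'"
  unfolding u'_alt by (intro continuous_intros)

lemma inner_u_u: "u \<phi> \<bullet> u \<psi> = cos (\<phi> - \<psi>)"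
  by (simp add: u_def inner_vec_def sum_2 cos_diff)

lemma inner_u_u': "u \<phi> \<bullet> u' \<psi> = sin (\<phi> - \<psi>)"
  by (simp add: u_def u'_def inner_vec_def sum_2 sin_diff)

lemma frame_expansion: "y = (u \<phi> \<bullet> y) *\<^sub>R u \<phi> + (u' \<phi> \<bullet> y) *\<^sub>R u' \<phi>"
proof -
  have "(cos \<phi> * a + sin \<phi> * b) * cos \<phi> - (cos \<phi> * b - sin \<phi> * a) * sin \<phi>
      = (cos \<phi> ^ 2 + sin \<phi> ^ 2) * a" for a b
    by algebra
  moreover have "(cos \<phi> * a + sin \<phi> * b) * sin \<phi> + (cos \<phi> * b - sin \<phi> * a) * cos \<phi>
      = (cos \<phi> ^ 2 + sin \<phi> ^ 2) * b" for a b
    by algebra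
  ultimately show ?thesis
    by (simp add: u_def u'_def inner_vec_def sum_2 vec_eq_iff forall_2)
qed

lemma u'_nonzero: "u' \<phi> \<noteq> 0"
proof
  assume "u' \<phi> = 0"
  then have "u (\<phi> + pi / 2) \<bullet> u' \<phi> = 0"
    by simp
  then show False
    by (simp add: inner_u_u')
qed

lemma u_periodic: "u (\<phi> + 2 * real k * pi) = u \<phi>"
  using sin.plus_of_nat[of \<phi> k] cos.plus_of_nat[of \<phi> k] by (simp add: u_def algebra_simps)

lemma u'_periodic: "u' (\<phi> + 2 * real k * pi) = u' \<phi>"
  using sin.plus_of_nat[of \<phi> k] cos.plus_of_nat[of \<phi> k] by (simp add: u'_def algebra_simps)

section \<open>Reduction to a period\<close>

definition reduce :: "real \<Rightarrow> real \<Rightarrow> real" where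
  "reduce L x = L * frac (x / L)"

lemma reduce_in_period: "L > 0 \<Longrightarrow> reduce L x \<in> {0..<L}"
  using frac_lt_1[of "x / L"] by (simp add: reduce_def)

lemma periodic_nat_multiple:
  fixes f :: "real \<Rightarrow> 'a"
  assumes "\<And>x. f (x + L) = f x"
  shows "f (x + real q * L) = f x"
proof (induction q)
  case (Suc q)
  have "f (x + real (Suc q) * L) = f ((x + real q * L) + L)"
    by (simp add: algebra_simps)
  then show ?case
    using Suc assms by simp
qed simp

lemma periodic_reduce:
  fixes f :: "real \<Rightarrow> 'a"
  assumes "L > 0" and per: "\<And>x. f (x + L) = f x"
  shows "f (reduce L x) = f x"
proof (cases "\<lfloor>x / L\<rfloor> \<ge> 0")
  case True
  have "x = reduce L x + real (nat \<lfloor>x / L\<rfloor>) * L"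
    using True \<open>L > 0\<close> by (simp add: reduce_def frac_def field_simps)
  then show ?thesis
    using periodic_nat_multiple[of f, OF per] by metis
next
  case False
  have "reduce L x = x + real (nat (- \<lfloor>x / L\<rfloor>)) * L"
    using False \<open>L > 0\<close> by (simp add: reduce_def frac_def field_simps)
  then show ?thesis
    using periodic_nat_multiple[of f, OF per] by metis
qed

section \<open>Tangents of a curve given by its support function\<close>

text \<open>The equation of the tangent with normal direction \<open>u \<phi>\<close> (Hesse normal form); it makes
  the incidences below a matter of evaluating inner products.\<close>

definition normal_line :: "(real \<Rightarrow> real) \<Rightarrow> real \<Rightarrow> (real^2) set" where
  "normal_line p \<phi> = {y. u \<phi> \<bullet> y = p \<phi>}"

lemma vertex_curve_on_both_lines:
  assumes "sin \<alpha> \<noteq> 0"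
  shows "vertex_curve p \<alpha> \<phi> \<in> normal_line p \<phi>"
    and "vertex_curve p \<alpha> \<phi> \<in> normal_line p (\<phi> + \<alpha>)"
  using assms by (simp_all add: vertex_curve_def normal_line_def inner_diff_right inner_u_u')

lemma normal_line_shift_neq:
  assumes "sin \<alpha> \<noteq> 0"
  shows "normal_line p \<phi> \<noteq> normal_line p (\<phi> + \<alpha>)"
proof
  assume eq: "normal_line p \<phi> = normal_line p (\<phi> + \<alpha>)"
  have "p \<phi> *\<^sub>R u \<phi> \<in> normal_line p \<phi>" "p \<phi> *\<^sub>R u \<phi> + u' \<phi> \<in> normal_line p \<phi>"
    by (simp_all add: normal_line_def inner_add_right inner_u_u inner_u_u')
  \<comment> \<open>Equal lines have the same direction, so \<open>u' \<phi>\<close> is orthogonal to \<open>u (\<phi> + \<alpha>)\<close>.\<close>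
  then have "u (\<phi> + \<alpha>) \<bullet> u' \<phi> = 0"
    unfolding eq by (simp add: normal_line_def inner_add_right)
  then show False
    using assms by (simp add: inner_u_u')
qed

locale support_function =
  fixes p p' p'' :: "real \<Rightarrow> real" and k :: nat
  assumes k_pos: "k > 0"
    and deriv_p: "\<And>\<phi>. (p has_real_derivative p' \<phi>) (at \<phi>)"
    and deriv_p': "\<And>\<phi>. (p' has_real_derivative p'' \<phi>) (at \<phi>)"
    and p_periodic: "\<And>\<phi>. p (\<phi> + 2 * real k * pi) = p \<phi>"
    and curvature_radius_pos: "\<And>\<phi>. p \<phi> + p'' \<phi> > 0"
begin

lemma period_pos: "2 * real k * pi > 0"
  using k_pos by simp

lemma continuous_p: "continuous_on S p"
  using deriv_p by (meson DERIV_isCont continuous_at_imp_continuous_on)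

lemma continuous_p': "continuous_on S p'"
  using deriv_p' by (meson DERIV_isCont continuous_at_imp_continuous_on)

lemma p'_periodic: "p' (\<phi> + 2 * real k * pi) = p' \<phi>"
proof -
  have "((\<lambda>x. p (x + 2 * real k * pi)) has_real_derivative p' (\<phi> + 2 * real k * pi)) (at \<phi>)"
    using deriv_p DERIV_shift by blast
  then show ?thesis
    unfolding p_periodic using deriv_p DERIV_unique by blast
qed

text \<open>The two terms \<open>p' u\<close> cancel, so the velocity is tangential to \<open>u'\<close> and its length
  is the radius of curvature.\<close>

lemma support_curve_deriv:
  "(support_curve p p' has_vector_derivative (p \<phi> + p'' \<phi>) *\<^sub>R u' \<phi>) (at \<phi>)"
proof -
  have "((\<lambda>x. p x *\<^sub>R u x + p' x *\<^sub>R u' x) has_vector_derivative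
      (p \<phi> *\<^sub>R u' \<phi> + p' \<phi> *\<^sub>R u \<phi>) + (p' \<phi> *\<^sub>R (- u \<phi>) + p'' \<phi> *\<^sub>R u' \<phi>)) (at \<phi>)"
    by (intro has_vector_derivative_add has_vector_derivative_scaleR deriv_p deriv_p'
        has_vector_derivative_u has_vector_derivative_u')
  then show ?thesis
    by (simp add: support_curve_def[abs_def] algebra_simps)
qed

lemma tangent_line_eq_normal_line: "tangent_line (support_curve p p') \<phi> = normal_line p \<phi>"
proof -
  have vd: "vector_derivative (support_curve p p') (at \<phi>) = (p \<phi> + p'' \<phi>) *\<^sub>R u' \<phi>"
    using support_curve_deriv by (rule vector_derivative_at)
  show ?thesis
  proof (intro equalityI subsetI)
    fix y assume "y \<in> tangent_line (support_curve p p') \<phi>"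
    then show "y \<in> normal_line p \<phi>"
      by (auto simp: tangent_line_def vd normal_line_def support_curve_def inner_add_right
          inner_u_u inner_u_u')
  next
    fix y assume "y \<in> normal_line p \<phi>"
    then have "y = p \<phi> *\<^sub>R u \<phi> + (u' \<phi> \<bullet> y) *\<^sub>R u' \<phi>"
      using frame_expansion[of y \<phi>] by (simp add: normal_line_def)
    also have "\<dots> = support_curve p p' \<phi>
        + ((u' \<phi> \<bullet> y - p' \<phi>) / (p \<phi> + p'' \<phi>)) *\<^sub>R ((p \<phi> + p'' \<phi>) *\<^sub>R u' \<phi>)"
      using curvature_radius_pos[of \<phi>] by (simp add: support_curve_def scaleR_diff_left)
    finally show "y \<in> tangent_line (support_curve p p') \<phi>"
      unfolding tangent_line_def vd by blast
  qed
qed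

lemma normal_line_periodic: "normal_line p (\<phi> + 2 * real k * pi) = normal_line p \<phi>"
  by (simp add: normal_line_def u_periodic p_periodic)

lemma closed_curve_support_curve: "closed_curve (2 * real k * pi) (support_curve p p')"
  unfolding closed_curve_def support_curve_def[abs_def]
  using period_pos
  by (auto intro!: continuous_intros continuous_p continuous_p'
      simp: p_periodic p'_periodic u_periodic u'_periodic)

lemma regular_curve_support_curve: "regular_curve (support_curve p p')"
proof -
  have "vector_derivative (support_curve p p') (at \<phi>) \<noteq> 0" for \<phi>
    using vector_derivative_at[OF support_curve_deriv, of \<phi>] u'_nonzero[of \<phi>]
      curvature_radius_pos[of \<phi>] by simp
  then show ?thesis
    unfolding regular_curve_def
    using support_curve_deriv differentiableI_vector by blast
qed

lemma continuous_vertex_curve: "continuous_on S (vertex_curve p \<alpha>)"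
proof -
  have "continuous_on S (\<lambda>\<phi>. p (\<phi> + \<alpha>))" "continuous_on S (\<lambda>\<phi>. u' (\<phi> + \<alpha>))"
    by (rule continuous_on_compose2[of UNIV p] continuous_on_compose2[of UNIV u'];
        auto intro!: continuous_intros continuous_p)+
  then show ?thesis
    unfolding vertex_curve_def[abs_def] by (intro continuous_intros continuous_p)
qed

lemma vertex_curve_periodic: "vertex_curve p \<alpha> (\<phi> + 2 * real k * pi) = vertex_curve p \<alpha> \<phi>"
proof -
  have "\<phi> + 2 * real k * pi + \<alpha> = (\<phi> + \<alpha>) + 2 * real k * pi"
    by simp
  then show ?thesis
    unfolding vertex_curve_def by (simp only: p_periodic u'_periodic)
qed

lemma closed_curve_vertex_curve: "closed_curve (2 * real k * pi) (vertex_curve p \<alpha>)"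
  unfolding closed_curve_def
  using period_pos continuous_vertex_curve vertex_curve_periodic by blast

text \<open>If all tangents passed through one point \<open>y\<close>, then \<open>p \<phi> = u \<phi> \<bullet> y\<close> would solve
  \<open>p + p'' = 0\<close>.\<close>

lemma tangents_not_concurrent: "\<exists>\<phi>. y \<notin> normal_line p \<phi>"
proof (rule ccontr)
  assume "\<not> ?thesis"
  then have p_eq: "p = (\<lambda>\<phi>. u \<phi> \<bullet> y)"
    by (auto simp: normal_line_def)
  have du: "((\<lambda>\<phi>. u \<phi> \<bullet> y) has_real_derivative u' \<phi> \<bullet> y) (at \<phi>)"
    and du': "((\<lambda>\<phi>. u' \<phi> \<bullet> y) has_real_derivative - (u \<phi> \<bullet> y)) (at \<phi>)" for \<phi>
    by (auto simp: u_def u'_def inner_vec_def sum_2 intro!: derivative_eq_intros)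
  have "p' = (\<lambda>\<phi>. u' \<phi> \<bullet> y)"
    using deriv_p DERIV_unique[OF _ du] unfolding p_eq by blast
  then have "p'' 0 = - (u 0 \<bullet> y)"
    using deriv_p'[of 0] DERIV_unique[OF _ du'[of 0]] by simp
  then show False
    using curvature_radius_pos[of 0] p_eq by simp
qed

lemma infinite_range_vertex_curve:
  assumes "sin \<alpha> \<noteq> 0"
  shows "infinite (range (vertex_curve p \<alpha>))"
proof
  assume "finite (range (vertex_curve p \<alpha>))"
  moreover have "connected (range (vertex_curve p \<alpha>))"
    using continuous_vertex_curve by (simp add: connected_continuous_image)
  ultimately obtain y where "range (vertex_curve p \<alpha>) = {y}"
    using connected_finite_iff_sing by blast
  then have "y \<in> normal_line p \<phi>" for \<phi>
    using vertex_curve_on_both_lines(1)[OF assms, of p \<phi>] by (metis rangeI singletonD)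
  then show False
    using tangents_not_concurrent by blast
qed

end

section \<open>Closing of the polygon\<close>

text \<open>The choice \<open>l = k\<close>, \<open>q = m\<close> shows that some number of rounds closes the polygon.\<close>

lemma closing_rounds_closes:
  assumes "k > 0"
  shows "closing_rounds k m > 0"
    and "\<exists>q::nat. 2 * pi * real m * real (closing_rounds k m) = real q * (2 * real k * pi)"
proof -
  have "k > 0 \<and> (\<exists>q::nat. 2 * pi * real m * real k = real q * (2 * real k * pi))"
    using assms by (auto intro!: exI[of _ m])
  from LeastI[of "\<lambda>l. l > 0 \<and> (\<exists>q::nat. 2 * pi * real m * real l = real q * (2 * real k * pi))",
      OF this]
  show "closing_rounds k m > 0"
    and "\<exists>q::nat. 2 * pi * real m * real (closing_rounds k m) = real q * (2 * real k * pi)"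
    unfolding closing_rounds_def by auto
qed

definition tangent_parameter :: "nat \<Rightarrow> nat \<Rightarrow> (nat \<Rightarrow> real) \<Rightarrow> real \<Rightarrow> nat \<Rightarrow> real" where
  "tangent_parameter m n \<alpha> \<phi> j =
     \<phi> + 2 * pi * real m * real (j div n) + (\<Sum>i < j mod n. \<alpha> i)"

text \<open>At the end of a round the sum over all \<open>n\<close> angles is exchanged for one more
  \<open>2 \<pi> m\<close>.\<close>

lemma tangent_parameter_Suc:
  assumes "n > 0" and "(\<Sum>i<n. \<alpha> i) = 2 * real m * pi"
  shows "tangent_parameter m n \<alpha> \<phi> (Suc j) = tangent_parameter m n \<alpha> \<phi> j + \<alpha> (j mod n)"
proof (cases "Suc (j mod n) = n")
  case True
  then have "(\<Sum>i < j mod n. \<alpha> i) + \<alpha> (j mod n) = 2 * real m * pi"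
    using assms(2) by (metis sum.lessThan_Suc)
  then show ?thesis
    using True by (simp add: tangent_parameter_def mod_Suc div_Suc algebra_simps)
next
  case False
  then show ?thesis
    by (simp add: tangent_parameter_def mod_Suc div_Suc)
qed

lemma tangent_parameter_add_rounds:
  assumes "n > 0"
  shows "tangent_parameter m n \<alpha> \<phi> (j + n * l)
    = tangent_parameter m n \<alpha> \<phi> j + 2 * pi * real m * real l"
  using assms by (simp add: tangent_parameter_def algebra_simps)

text \<open>Side \<open>j\<close> joins the vertices \<open>j\<close> and \<open>j + 1\<close>, so it lies on the tangent that these have
  in common, the one with parameter \<open>\<theta> (j + 1)\<close>. Indices modulo the number of vertices do no
  harm: passing once around the polygon changes \<open>\<theta>\<close> by a multiple of the period.\<close>

lemma (in support_function) poncelet_polygon_polygon_P: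
  assumes "n > 0" and angle_sum: "(\<Sum>i<n. \<alpha> i) = 2 * real m * pi"
    and sin_nz: "\<And>i. i < n \<Longrightarrow> sin (\<alpha> i) \<noteq> 0"
  shows "poncelet_polygon (2 * real k * pi) n (support_curve p p') (\<lambda>i. vertex_curve p (\<alpha> i))
    (polygon_P p k m n \<alpha> \<phi>)"
proof -
  define L where "L = 2 * real k * pi"
  define N where "N = n * closing_rounds k m"
  define \<theta> where "\<theta> = tangent_parameter m n \<alpha> \<phi>"
  define v where "v j = vertex_curve p (\<alpha> (j mod n)) (\<theta> j)" for j
  define V where "V = polygon_P p k m n \<alpha> \<phi>"
  have L: "L > 0"
    using period_pos by (simp add: L_def)
  have N: "N > 0"
    using closing_rounds_closes(1)[OF k_pos] \<open>n > 0\<close> by (simp add: N_def)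
  have V: "length V = N" "\<And>j. j < N \<Longrightarrow> V ! j = v j"
    by (simp_all add: V_def N_def v_def \<theta>_def polygon_P_def tangent_parameter_def)
  have step: "\<theta> (Suc j) = \<theta> j + \<alpha> (j mod n)" for j
    unfolding \<theta>_def by (rule tangent_parameter_Suc[OF \<open>n > 0\<close> angle_sum])
  obtain q :: nat where q: "2 * pi * real m * real (closing_rounds k m) = real q * L"
    using closing_rounds_closes(2)[OF k_pos] unfolding L_def by blast
  have \<theta>_N: "\<theta> (j + N) = \<theta> j + real q * L" for j
    unfolding \<theta>_def N_def tangent_parameter_add_rounds[OF \<open>n > 0\<close>] q ..
  have line_N: "normal_line p (\<theta> (j + N)) = normal_line p (\<theta> j)" for j
    unfolding \<theta>_N using normal_line_periodic
    by (intro periodic_nat_multiple[of "normal_line p"]) (simp add: L_def)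
  have v_N: "v (j + N) = v j" for j
  proof -
    have "(j + N) mod n = j mod n"
      by (simp add: N_def)
    then show ?thesis
      unfolding v_def \<theta>_N using vertex_curve_periodic
      by (simp add: periodic_nat_multiple L_def)
  qed
  have sin_nz': "sin (\<alpha> (j mod n)) \<noteq> 0" for j
    using sin_nz \<open>n > 0\<close> by simp
  have v_on: "v j \<in> normal_line p (\<theta> j)" "v j \<in> normal_line p (\<theta> (Suc j))" for j
    unfolding v_def step by (rule vertex_curve_on_both_lines[OF sin_nz'])+
  have line_neq: "normal_line p (\<theta> j) \<noteq> normal_line p (\<theta> (Suc j))" for j
    unfolding step by (rule normal_line_shift_neq[OF sin_nz'])
  have Suc_mod: "v (Suc j mod N) = v (Suc j)"
    "normal_line p (\<theta> (Suc (Suc j mod N))) = normal_line p (\<theta> (Suc (Suc j)))" if "j < N" for j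
  proof -
    have "Suc j mod N = Suc j \<or> Suc j mod N = 0 \<and> Suc j = 0 + N"
      using that by (auto simp: mod_Suc)
    then show "v (Suc j mod N) = v (Suc j)"
      "normal_line p (\<theta> (Suc (Suc j mod N))) = normal_line p (\<theta> (Suc (Suc j)))"
      using v_N[of 0] line_N[of "Suc 0"] by auto
  qed
  have tangent: "tangent_line (support_curve p p') (reduce L (\<theta> j)) = normal_line p (\<theta> j)" for j
    unfolding tangent_line_eq_normal_line using normal_line_periodic
    by (intro periodic_reduce[of _ "normal_line p"] L) (simp add: L_def)
  have "circumscribed L (support_curve p p') V"
    unfolding circumscribed_def
  proof (intro exI[of _ "\<lambda>j. reduce L (\<theta> (Suc j))"] allI impI conjI)
    fix j assume "j < length V"
    then have j: "j < N" "Suc j mod N < N"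
      using V(1) N by simp_all
    show "reduce L (\<theta> (Suc j)) \<in> {0..<L}"
      using L by (rule reduce_in_period)
    have "convex (normal_line p (\<theta> (Suc j)))"
      unfolding normal_line_def by (rule convex_hyperplane)
    then have "closed_segment (v j) (v (Suc j)) \<subseteq> normal_line p (\<theta> (Suc j))"
      using v_on by (intro closed_segment_subset)
    then show "closed_segment (V ! j) (V ! (Suc j mod length V))
        \<subseteq> tangent_line (support_curve p p') (reduce L (\<theta> (Suc j)))"
      using V j Suc_mod(1) tangent by simp
    show "tangent_line (support_curve p p') (reduce L (\<theta> (Suc j)))
        \<noteq> tangent_line (support_curve p p') (reduce L (\<theta> (Suc (Suc j mod length V))))"
      using line_neq V(1) j Suc_mod(2) tangent by simp
  qed
  moreover have "V ! j \<in> vertex_curve p (\<alpha> (j mod n)) ` {0..<L}" if "j < N" for j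
  proof -
    have "vertex_curve p (\<alpha> (j mod n)) (reduce L (\<theta> j)) = V ! j"
      unfolding V(2)[OF that] v_def using vertex_curve_periodic
      by (intro periodic_reduce L) (simp add: L_def)
    then show ?thesis
      using reduce_in_period[OF L] by (metis imageI)
  qed
  moreover have "V \<noteq> []" "n dvd length V"
    using V(1) N by (auto simp: N_def)
  ultimately show ?thesis
    unfolding poncelet_polygon_def V_def[symmetric] L_def[symmetric] using V(1) by blast
qed

theorem corollary11:
  fixes p p' p'' :: "real \<Rightarrow> real" and k m n :: nat and \<alpha> :: "nat \<Rightarrow> real"
  assumes "k > 0"
    and "\<And>\<phi>. (p has_real_derivative p' \<phi>) (at \<phi>)"
    and "\<And>\<phi>. (p' has_real_derivative p'' \<phi>) (at \<phi>)"
    and "continuous_on UNIV p''"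
    and "\<And>\<phi>. p (\<phi> + 2 * real k * pi) = p \<phi>"
    and "\<And>\<phi>. p \<phi> + p'' \<phi> > 0"
    and "\<And>i (z :: int). i < n \<Longrightarrow> \<alpha> i \<noteq> of_int z * pi"
    and "m \<ge> 1"
    and "(\<Sum>i<n. \<alpha> i) = 2 * real m * pi"
  shows "poncelet_clan (2 * real k * pi) n (support_curve p p') (\<lambda>i. vertex_curve p (\<alpha> i))
    \<and> (\<forall>\<phi>. poncelet_polygon (2 * real k * pi) n (support_curve p p')
                (\<lambda>i. vertex_curve p (\<alpha> i)) (polygon_P p k m n \<alpha> \<phi>))"
proof -
  interpret support_function p p' p'' k
    using assms by unfold_locales
  let ?poncelet = "poncelet_polygon (2 * real k * pi) n (support_curve p p')
    (\<lambda>i. vertex_curve p (\<alpha> i))"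
  have n: "n > 0"
    using assms(8,9) by (cases n) auto
  have sin_nz: "sin (\<alpha> i) \<noteq> 0" if "i < n" for i
    using assms(7)[OF that] by (auto simp: sin_zero_iff_int2)
  have polygon: "?poncelet (polygon_P p k m n \<alpha> \<phi>)" for \<phi>
    using n assms(9) sin_nz by (rule poncelet_polygon_polygon_P)
  have first_vertex: "vertex_curve p (\<alpha> 0) \<phi> \<in> set (polygon_P p k m n \<alpha> \<phi>)" for \<phi>
    using n closing_rounds_closes(1)[OF \<open>k > 0\<close>, of m]
    by (auto simp: polygon_P_def intro!: image_eqI[where x = 0])
  have "infinite (set ` {V. ?poncelet V})"
  proof
    assume "finite (set ` {V. ?poncelet V})"
    then have "finite (\<Union> (set ` {V. ?poncelet V}))"
      by (rule finite_Union) auto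
    moreover have "range (vertex_curve p (\<alpha> 0)) \<subseteq> \<Union> (set ` {V. ?poncelet V})"
      using polygon first_vertex by blast
    ultimately show False
      using infinite_range_vertex_curve sin_nz n finite_subset by blast
  qed
  then show ?thesis
    unfolding poncelet_clan_def
    using polygon closed_curve_support_curve regular_curve_support_curve closed_curve_vertex_curve
    by blast
qed

end
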